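(* Let $X,Y,Z$ be random variables with finite ranges $\mathbf{X},\mathbf{Y},\mathbf{Z}$, and let $b^{\mathtt y}\in\mathbb{R}^{\mathbf{X}\times\mathbf{Y}}$ and $b^{\mathtt z}\in\mathbb{R}^{\mathbf{X}\times\mathbf{Z}}$ be the marginal distributions of $(X,Y)$ and $(X,Z)$. Consider the Convex Program (CP), with variable $q\in\mathbb{R}^{\mathbf{X}\times\mathbf{Y}\times\mathbf{Z}}$: $$\text{minimize } \sum_{x,y,z} q_{x,y,z}\ln\frac{q_{x,y,z}}{q_{*,y,z}}$$ subject to $q_{x,y,*}=b^{\mathtt y}_{x,y}$ for all $(x,y)\in\mathbf{X}\times\mathbf{Y}$, $q_{x,*,z}=b^{\mathtt z}_{x,z}$ for all $(x,z)\in\mathbf{X}\times\mathbf{Z}$, and $q_{x,y,z}\ge 0$ for all $(x,y,z)\in\mathbf{X}\times\mathbf{Y}\times\mathbf{Z}$. Consider also the exponential cone program (EXP), with variables $r,p,q\in\mathbb{R}^{\mathbf{X}\times\mathbf{Y}\times\mathbf{Z}}$: $$\text{minimize } -\sum_{x,y,z} r_{x,y,z}$$ subject to $q_{x,y,*}=b^{\mathtt y}_{x,y}$ for all $(x,y)\in\mathbf{X}\times\mathbf{Y}$, $q_{x,*,z}=b^{\mathtt z}_{x,z}$ for all $(x,z)\in\mathbf{X}\times\mathbf{Z}$, and, for all $(x,y,z)\in\mathbf{X}\times\mathbf{Y}\times\mathbf{Z}$, $q_{*,y,z}-p_{x,y,z}=0$ and $(-r_{x,y,z},-p_{x,y,z},-q_{x,y,z})\le_{\mathcal{K}_{\exp}}0$.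 Then the exponential cone program (EXP) is equivalent to the Convex Program (CP).
   Context: An asterisk in an index position denotes summation over that index, e.g. $q_{x,y,*}=\sum_{z\in\mathbf{Z}}q_{x,y,z}$, $q_{x,*,z}=\sum_{y\in\mathbf{Y}}q_{x,y,z}$, $q_{*,y,z}=\sum_{x\in\mathbf{X}}q_{x,y,z}$. If $P\in\mathbb{R}^{\mathbf{X}\times\mathbf{Y}\times\mathbf{Z}}$ is the joint probability distribution of $(X,Y,Z)$, the marginals are $b^{\mathtt y}_{x,y}=P_{x,y,*}$ and $b^{\mathtt z}_{x,z}=P_{x,*,z}$. In the objective of (CP), the term $q_{x,y,z}\ln\frac{q_{x,y,z}}{q_{*,y,z}}$ is taken to be $0$ when $q_{x,y,z}=0$. For a closed convex cone $\mathcal{K}\subseteq\mathbb{R}^m$ and $a,b\in\mathbb{R}^m$, the generalized inequality $a\le_{\mathcal{K}}b$ means $b-a\in\mathcal{K}$; thus $(-r,-p,-q)\le_{\mathcal{K}_{\exp}}0$ means $(r,p,q)\in\mathcal{K}_{\exp}$. The exponential cone is the closed convex cone $$\mathcal{K}_{\exp}=\{(r,p,q)\in\mathbb{R}^3 \mid q>0 \text{ and } q e^{r/q}\le p\}\cup\{(r,p,0)\in\mathbb{R}^3\mid r\le 0\text{ and }p\ge 0\}.$$ *)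

theory Defs
  imports "HOL-Probability.Probability"
begin

text \<open>The finite ranges of the random variables are finite types, so that an array indexed by
  them is a curried real function. The next three functions sum out one index (the index
  written as an asterisk).\<close>

definition sum_x :: "('x::finite \<Rightarrow> 'y \<Rightarrow> 'z \<Rightarrow> real) \<Rightarrow> 'y \<Rightarrow> 'z \<Rightarrow> real" where
  "sum_x q y z = (\<Sum>x\<in>UNIV. q x y z)"

definition sum_y :: "('x \<Rightarrow> 'y::finite \<Rightarrow> 'z \<Rightarrow> real) \<Rightarrow> 'x \<Rightarrow> 'z \<Rightarrow> real" where
  "sum_y q x z = (\<Sum>y\<in>UNIV. q x y z)"

definition sum_z :: "('x \<Rightarrow> 'y \<Rightarrow> 'z::finite \<Rightarrow> real) \<Rightarrow> 'x \<Rightarrow> 'y \<Rightarrow> real" where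
  "sum_z q x y = (\<Sum>z\<in>UNIV. q x y z)"

definition joint_distribution ::
  "'w measure \<Rightarrow> ('w \<Rightarrow> 'x) \<Rightarrow> ('w \<Rightarrow> 'y) \<Rightarrow> ('w \<Rightarrow> 'z) \<Rightarrow> 'x \<Rightarrow> 'y \<Rightarrow> 'z \<Rightarrow> real" where
  "joint_distribution M X Y Z x y z = \<P>(w in M. X w = x \<and> Y w = y \<and> Z w = z)"

datatype 'v min_program = Min_Program (feasible: "'v set") (objective: "'v \<Rightarrow> real")

text \<open>The value is extended real: it is \<open>\<infinity>\<close> for an infeasible program and \<open>-\<infinity>\<close> for an unbounded one.\<close>

definition optimal_value :: "'v min_program \<Rightarrow> ereal" where
  "optimal_value P = (INF v\<in>feasible P. ereal (objective P v))"

definition optimal_solutions :: "'v min_program \<Rightarrow> 'v set" where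
  "optimal_solutions P = {v \<in> feasible P. \<forall>w\<in>feasible P. objective P v \<le> objective P w}"

text \<open>Equivalence of minimization programs, with respect to explicitly given translations in both
  directions: \<open>\<phi>\<close> carries feasible points of \<open>P\<close> to feasible points of \<open>Q\<close> with the same objective
  value, \<open>\<psi>\<close> carries feasible points of \<open>Q\<close> to feasible points of \<open>P\<close> that are at least as good,
  the optimal values agree, and \<open>\<phi>\<close>, \<open>\<psi>\<close> restrict to mutually inverse bijections between the
  sets of optimal solutions. The translations are parameters because their mere
  existence would say little: any two solution sets of equal cardinality are in bijection.\<close>

definition equivalent_programs_via ::
  "('u \<Rightarrow> 'v) \<Rightarrow> ('v \<Rightarrow> 'u) \<Rightarrow> 'u min_program \<Rightarrow> 'v min_program \<Rightarrow> bool" where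
  "equivalent_programs_via \<phi> \<psi> P Q \<longleftrightarrow>
     (\<forall>u\<in>feasible P. \<phi> u \<in> feasible Q \<and> objective Q (\<phi> u) = objective P u) \<and>
     (\<forall>v\<in>feasible Q. \<psi> v \<in> feasible P \<and> objective P (\<psi> v) \<le> objective Q v) \<and>
     optimal_value P = optimal_value Q \<and>
     (\<forall>u\<in>optimal_solutions P. \<phi> u \<in> optimal_solutions Q \<and> \<psi> (\<phi> u) = u) \<and>
     (\<forall>v\<in>optimal_solutions Q. \<psi> v \<in> optimal_solutions P \<and> \<phi> (\<psi> v) = v)"

definition cone_le :: "'a::ab_group_add set \<Rightarrow> 'a \<Rightarrow> 'a \<Rightarrow> bool" where
  "cone_le K a b \<longleftrightarrow> b - a \<in> K"

definition exp_cone :: "(real \<times> real \<times> real) set" where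
  "exp_cone = {(r, p, q) | r p q. q > 0 \<and> q * exp (r / q) \<le> p} \<union>
              {(r, p, 0) | r p. r \<le> 0 \<and> p \<ge> 0}"

definition CP ::
  "('x::finite \<Rightarrow> 'y::finite \<Rightarrow> real) \<Rightarrow> ('x \<Rightarrow> 'z::finite \<Rightarrow> real) \<Rightarrow>
   ('x \<Rightarrow> 'y \<Rightarrow> 'z \<Rightarrow> real) min_program" where
  "CP b_y b_z = Min_Program
     {q. (\<forall>x y. sum_z q x y = b_y x y) \<and>
         (\<forall>x z. sum_y q x z = b_z x z) \<and>
         (\<forall>x y z. q x y z \<ge> 0)}
     (\<lambda>q. \<Sum>x\<in>UNIV. \<Sum>y\<in>UNIV. \<Sum>z\<in>UNIV.
        if q x y z = 0 then 0 else q x y z * ln (q x y z / sum_x q y z))"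

definition EXP ::
  "('x::finite \<Rightarrow> 'y::finite \<Rightarrow> real) \<Rightarrow> ('x \<Rightarrow> 'z::finite \<Rightarrow> real) \<Rightarrow>
   (('x \<Rightarrow> 'y \<Rightarrow> 'z \<Rightarrow> real) \<times> ('x \<Rightarrow> 'y \<Rightarrow> 'z \<Rightarrow> real) \<times> ('x \<Rightarrow> 'y \<Rightarrow> 'z \<Rightarrow> real)) min_program" where
  "EXP b_y b_z = Min_Program
     {(r, p, q) | r p q.
         (\<forall>x y. sum_z q x y = b_y x y) \<and>
         (\<forall>x z. sum_y q x z = b_z x z) \<and>
         (\<forall>x y z. sum_x q y z - p x y z = 0) \<and>
         (\<forall>x y z. cone_le exp_cone (- r x y z, - p x y z, - q x y z) 0)}
     (\<lambda>(r, p, q). - (\<Sum>x\<in>UNIV. \<Sum>y\<in>UNIV. \<Sum>z\<in>UNIV. r x y z))"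

text \<open>\<open>CP_to_EXP\<close> chooses \<open>p\<close> as the equality constraint forces and each
  \<open>r x y z\<close> as large as the cone constraint permits; \<open>EXP_to_CP\<close> keeps only \<open>q\<close>.\<close>

definition CP_to_EXP ::
  "('x::finite \<Rightarrow> 'y \<Rightarrow> 'z \<Rightarrow> real) \<Rightarrow>
   ('x \<Rightarrow> 'y \<Rightarrow> 'z \<Rightarrow> real) \<times> ('x \<Rightarrow> 'y \<Rightarrow> 'z \<Rightarrow> real) \<times> ('x \<Rightarrow> 'y \<Rightarrow> 'z \<Rightarrow> real)" where
  "CP_to_EXP q =
     ((\<lambda>x y z. if q x y z = 0 then 0 else q x y z * ln (sum_x q y z / q x y z)),
      (\<lambda>x y z. sum_x q y z),
      q)"

definition EXP_to_CP ::
  "('x \<Rightarrow> 'y \<Rightarrow> 'z \<Rightarrow> real) \<times> ('x \<Rightarrow> 'y \<Rightarrow> 'z \<Rightarrow> real) \<times> ('x \<Rightarrow> 'y \<Rightarrow> 'z \<Rightarrow> real) \<Rightarrow>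
   ('x \<Rightarrow> 'y \<Rightarrow> 'z \<Rightarrow> real)" where
  "EXP_to_CP = (\<lambda>(r, p, q). q)"

end

theory Submission
  imports Defs
begin

text \<open>For \<open>0 \<le> q \<le> p\<close>, membership of \<open>(r, p, q)\<close> in the exponential cone says \<open>r \<le> q ln (p / q)\<close>
  (read as \<open>r \<le> 0\<close> if \<open>q = 0\<close>). Hence, for fixed \<open>q\<close>, the point \<open>CP_to_EXP q\<close> is the unique
  best feasible point of (EXP) above \<open>q\<close>, and its objective value is that of \<open>q\<close> in (CP).\<close>

text \<open>Reduces equivalence to conditions on feasible points alone. The optimal values agree
  because each translation never worsens the objective. \<open>tight\<close> carries uniqueness: a
  point of \<open>Q\<close> that gains nothing under \<open>\<psi>\<close> already lies in the image
  of \<open>\<phi>\<close>, and optimal points are of this kind.\<close>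

lemma equivalent_programs_viaI:
  assumes to: "\<And>u. u \<in> feasible P \<Longrightarrow> \<phi> u \<in> feasible Q"
    and obj_to: "\<And>u. u \<in> feasible P \<Longrightarrow> objective Q (\<phi> u) = objective P u"
    and fro: "\<And>v. v \<in> feasible Q \<Longrightarrow> \<psi> v \<in> feasible P"
    and obj_fro: "\<And>v. v \<in> feasible Q \<Longrightarrow> objective P (\<psi> v) \<le> objective Q v"
    and inv: "\<And>u. u \<in> feasible P \<Longrightarrow> \<psi> (\<phi> u) = u"
    and tight: "\<And>v. v \<in> feasible Q \<Longrightarrow> objective P (\<psi> v) = objective Q v \<Longrightarrow> \<phi> (\<psi> v) = v"
  shows "equivalent_programs_via \<phi> \<psi> P Q"
proof -
  have "optimal_value P = optimal_value Q"
    unfolding optimal_value_def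
  proof (rule antisym)
    show "(INF u\<in>feasible P. ereal (objective P u)) \<le> (INF v\<in>feasible Q. ereal (objective Q v))"
      by (rule INF_mono) (use fro obj_fro in auto)
    show "(INF v\<in>feasible Q. ereal (objective Q v)) \<le> (INF u\<in>feasible P. ereal (objective P u))"
      by (rule INF_mono) (metis to obj_to order_refl)
  qed
  moreover have "\<phi> u \<in> optimal_solutions Q \<and> \<psi> (\<phi> u) = u" if u: "u \<in> optimal_solutions P" for u
  proof -
    have uP: "u \<in> feasible P"
      using u by (simp add: optimal_solutions_def)
    have opt: "objective P u \<le> objective P w" if "w \<in> feasible P" for w
      using u that by (simp add: optimal_solutions_def)
    have "objective Q (\<phi> u) \<le> objective Q v" if "v \<in> feasible Q" for v
      using opt[OF fro[OF that]] obj_fro[OF that] uP by (simp add: obj_to)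
    then show ?thesis
      using u to inv by (simp add: optimal_solutions_def)
  qed
  moreover have "\<psi> v \<in> optimal_solutions P \<and> \<phi> (\<psi> v) = v" if v: "v \<in> optimal_solutions Q" for v
  proof -
    have opt: "objective Q v \<le> objective P u" if "u \<in> feasible P" for u
      using v to[OF that] obj_to[OF that] by (auto simp: optimal_solutions_def)
    have vQ: "v \<in> feasible Q"
      using v by (simp add: optimal_solutions_def)
    \<comment> \<open>An optimal \<open>v\<close> cannot be improved:
      \<open>\<phi> (\<psi> v)\<close> competes with it in \<open>Q\<close> and has the objective
      value of \<open>\<psi> v\<close>.\<close>
    have eq: "objective P (\<psi> v) = objective Q v"
      using obj_fro[OF vQ] opt[OF fro[OF vQ]] by simp
    then show ?thesis
      using fro[OF vQ] opt tight[OF vQ] by (auto simp add: optimal_solutions_def)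
  qed
  ultimately show ?thesis
    using to obj_to fro obj_fro by (simp add: equivalent_programs_via_def)
qed

lemma exp_cone_nonneg: "(r, p, q) \<in> exp_cone \<Longrightarrow> 0 \<le> q"
  by (auto simp: exp_cone_def)

text \<open>For \<open>q > 0\<close>, divide by \<open>q\<close> and take logarithms;
  \<open>q \<le> p\<close> makes \<open>p / q\<close> positive. For \<open>q = 0\<close> it yields
  the condition \<open>p \<ge> 0\<close> of the boundary face.\<close>

lemma exp_cone_iff:
  assumes "0 \<le> q" "q \<le> p"
  shows "(r, p, q) \<in> exp_cone \<longleftrightarrow> r \<le> (if q = 0 then 0 else q * ln (p / q))"
proof (cases "q = 0")
  case True
  then show ?thesis using assms by (simp add: exp_cone_def)
next
  case False
  then have "0 < q" "0 < p / q" using assms by auto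
  then have "q * exp (r / q) \<le> p \<longleftrightarrow> r / q \<le> ln (p / q)"
    by (simp add: ln_ge_iff pos_le_divide_eq mult.commute)
  also have "\<dots> \<longleftrightarrow> r \<le> q * ln (p / q)"
    using \<open>0 < q\<close> by (simp add: pos_divide_le_eq mult.commute)
  finally show ?thesis using \<open>0 < q\<close> by (simp add: exp_cone_def)
qed

lemma le_sum_x:
  assumes "\<And>x y z. 0 \<le> q x y z"
  shows "q x y z \<le> sum_x q y z"
  unfolding sum_x_def by (rule member_le_sum) (use assms in auto)

text \<open>Above a fixed \<open>q\<close>, the equality constraint pins \<open>p\<close> and the
  cone only bounds \<open>r\<close> entrywise from above. The sign constraint of (CP), not listed in
  (EXP), is implied by the cone.\<close>

lemma feasible_EXP_iff:
  "(r, p, q) \<in> feasible (EXP b_y b_z) \<longleftrightarrow>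
     q \<in> feasible (CP b_y b_z) \<and> p = fst (snd (CP_to_EXP q)) \<and>
     (\<forall>x y z. r x y z \<le> fst (CP_to_EXP q) x y z)" (is "?L \<longleftrightarrow> ?R")
proof -
  have cone: "(\<forall>x y z. (r x y z, sum_x q y z, q x y z) \<in> exp_cone) \<longleftrightarrow>
      (\<forall>x y z. 0 \<le> q x y z) \<and> (\<forall>x y z. r x y z \<le> fst (CP_to_EXP q) x y z)"
  \<comment> \<open>Nonnegativity gives \<open>q x y z \<le> sum_x q y z\<close>, so
    \<open>exp_cone_iff\<close> applies; without it both sides are false.\<close>
  proof (cases "\<forall>x y z. 0 \<le> q x y z")
    case True
    then show ?thesis by (simp add: exp_cone_iff le_sum_x CP_to_EXP_def)
  next
    case False
    then show ?thesis using exp_cone_nonneg by blast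
  qed
  have p: "(\<forall>x y z. sum_x q y z - p x y z = 0) \<longleftrightarrow> p = fst (snd (CP_to_EXP q))"
    by (auto simp: CP_to_EXP_def fun_eq_iff)
  have "?L \<longleftrightarrow> (\<forall>x y. sum_z q x y = b_y x y) \<and> (\<forall>x z. sum_y q x z = b_z x z) \<and>
      p = fst (snd (CP_to_EXP q)) \<and> (\<forall>x y z. (r x y z, p x y z, q x y z) \<in> exp_cone)"
    unfolding EXP_def cone_le_def p[symmetric] by (simp add: zero_prod_def)
  also have "\<dots> \<longleftrightarrow> (\<forall>x y. sum_z q x y = b_y x y) \<and> (\<forall>x z. sum_y q x z = b_z x z) \<and>
      p = fst (snd (CP_to_EXP q)) \<and> (\<forall>x y z. (r x y z, sum_x q y z, q x y z) \<in> exp_cone)"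
    by (auto simp: CP_to_EXP_def)
  also have "\<dots> \<longleftrightarrow> ?R"
    unfolding cone by (auto simp: CP_def)
  finally show ?thesis .
qed

lemma objective_CP_eq:
  "objective (CP b_y b_z) q = - (\<Sum>x\<in>UNIV. \<Sum>y\<in>UNIV. \<Sum>z\<in>UNIV. fst (CP_to_EXP q) x y z)"
proof -
  \<comment> \<open>No sign condition is imposed: if \<open>a\<close> or \<open>s\<close> is 0, both
    sides are 0, since division by 0 and \<open>ln 0\<close> evaluate to 0.\<close>
  have "a * ln (a / s) = - (a * ln (s / a))" for a s :: real
    by (metis inverse_divide ln_inverse mult_minus_right)
  then show ?thesis
    by (simp add: CP_def CP_to_EXP_def sum_negf[symmetric] if_distrib[of uminus] cong: if_cong)
qed

theorem proposition4:
  fixes M :: "'w measure"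
    and X :: "'w \<Rightarrow> 'x::finite"
    and Y :: "'w \<Rightarrow> 'y::finite"
    and Z :: "'w \<Rightarrow> 'z::finite"
    and b_y :: "'x \<Rightarrow> 'y \<Rightarrow> real"
    and b_z :: "'x \<Rightarrow> 'z \<Rightarrow> real"
  assumes "prob_space M"
    and "X \<in> measurable M (count_space UNIV)"
    and "Y \<in> measurable M (count_space UNIV)"
    and "Z \<in> measurable M (count_space UNIV)"
    and "b_y = sum_z (joint_distribution M X Y Z)"
    and "b_z = sum_y (joint_distribution M X Y Z)"
  shows "equivalent_programs_via CP_to_EXP EXP_to_CP (CP b_y b_z) (EXP b_y b_z)"
proof (rule equivalent_programs_viaI)
  fix q assume "q \<in> feasible (CP b_y b_z)"
  then show "CP_to_EXP q \<in> feasible (EXP b_y b_z)"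
    using feasible_EXP_iff[of "fst (CP_to_EXP q)" "fst (snd (CP_to_EXP q))" q]
    by (simp add: CP_to_EXP_def)
  show "objective (EXP b_y b_z) (CP_to_EXP q) = objective (CP b_y b_z) q"
    unfolding objective_CP_eq by (simp add: EXP_def CP_to_EXP_def)
  show "EXP_to_CP (CP_to_EXP q) = q"
    by (simp add: EXP_to_CP_def CP_to_EXP_def)
next
  fix v assume v: "v \<in> feasible (EXP b_y b_z)"
  obtain r p q where v_eq: "v = (r, p, q)" by (cases v)
  let ?S = "\<lambda>r :: 'x \<Rightarrow> 'y \<Rightarrow> 'z \<Rightarrow> real. \<Sum>x\<in>UNIV. \<Sum>y\<in>UNIV. \<Sum>z\<in>UNIV. r x y z"
  let ?r = "fst (CP_to_EXP q)"
  have q: "q \<in> feasible (CP b_y b_z)" and p: "p = fst (snd (CP_to_EXP q))"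
    and le: "\<And>x y z. r x y z \<le> ?r x y z"
    using v unfolding v_eq feasible_EXP_iff by auto
  have \<psi>: "EXP_to_CP v = q" and obj: "objective (EXP b_y b_z) v = - ?S r"
    by (simp_all add: v_eq EXP_to_CP_def EXP_def)
  show "EXP_to_CP v \<in> feasible (CP b_y b_z)"
    using q \<psi> by simp
  show "objective (CP b_y b_z) (EXP_to_CP v) \<le> objective (EXP b_y b_z) v"
    unfolding \<psi> obj objective_CP_eq by (simp add: sum_mono le)
  assume "objective (CP b_y b_z) (EXP_to_CP v) = objective (EXP b_y b_z) v"
  \<comment> \<open>Equal objectives mean that the total slack in the bounds on \<open>r\<close> is
    0. Each slack is nonnegative by \<open>le\<close>, so all of them vanish.\<close>
  then have "?S (\<lambda>x y z. ?r x y z - r x y z) = 0"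
    unfolding \<psi> obj objective_CP_eq by (simp add: sum_subtractf)
  then have "r = ?r"
    by (auto simp: fun_eq_iff sum_nonneg_eq_0_iff sum_nonneg le)
  with p have "CP_to_EXP q = v"
    by (simp add: v_eq CP_to_EXP_def)
  then show "CP_to_EXP (EXP_to_CP v) = v"
    by (simp only: \<psi>)
qed

end
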